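(* Let $\mathscr{A}=\{a_1,\ldots,a_n\}\subset\mathbb{Z}$ be a finite set with $0<a_1<\cdots<a_n$, $\gcd(a_1,\ldots,a_n)=1$ and $1<a_1$. Then $a_1\geq F_{\delta(\mathscr{A})+1}$ and $a_2\geq F_{\delta(\mathscr{A})+2}$.
   Context: Fibonacci sequence (with this indexing): $F_1:=1$, $F_2:=2$, $F_{m+2}:=F_{m+1}+F_m$ for $m\geq1$. For a finite set $\mathscr{A}=\{a_1,\ldots,a_n\}$ of integers with $0<a_1<\cdots<a_n$ and gcd $1$, put $\mathscr{A}':=\{a_1\}\cup\{a_2-a_1,\ldots,a_n-a_1\}$ (a set of positive integers with gcd $1$, reordered increasingly), $\mathscr{A}^1:=\mathscr{A}'$, and $\mathscr{A}^k:=(\mathscr{A}^{k-1})'$ for $k\geq2$. The algorithm iterates $\mathscr{A}\mapsto\mathscr{A}'$ until the set contains $1$. Number of division algorithms $\delta(\mathscr{A})$ (for $a_1>1$): the iteration is grouped into division algorithms as follows. Start with $\mathscr{B}:=\mathscr{A}$. While $\min(\mathscr{B})>1$: first discard from $\mathscr{B}$ all multiples of $\min(\mathscr{B})$ other than $\min(\mathscr{B})$ itself; let $b_1<b_2$ be the two smallest elements of the resulting set $\mathscr{B}$ (it has at least two elements since its gcd is $1$ and $b_1>1$); perform the division $b_2=b_1q+r$ with $0<r<b_1$; then replace $\mathscr{B}$ by $\mathscr{B}^q$, whose minimum is $r$. Each pass through this loop counts as one division algorithm, and $\delta(\mathscr{A})$ is the total number of passes until $1$ belongs to the set. *)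

theory Defs
  imports "HOL-Number_Theory.Fib"
begin

text \<open>Fibonacci numbers indexed by \<open>F 1 = 1\<close>, \<open>F 2 = 2\<close>: the library's \<^const>\<open>fib\<close> shifted by
  one. The value at \<open>0\<close> is not meaningful.\<close>

definition F :: "nat \<Rightarrow> nat" where
  "F m = fib (m + 1)"

lemma F_1: "F 1 = 1"
  and F_2: "F 2 = 2"
  and F_rec: "F (m + 2) = F (m + 1) + F m"
  by (simp_all add: F_def numeral_2_eq_2)

definition derived :: "int set \<Rightarrow> int set" where
  "derived A = insert (Min A) ((\<lambda>x. x - Min A) ` (A - {Min A}))"

definition discard_multiples :: "int set \<Rightarrow> int set" where
  "discard_multiples B = {b \<in> B. Min B dvd b \<longrightarrow> b = Min B}"

text \<open>The set \<open>B\<^sup>q\<close> is \<open>(derived ^^ q) B\<close>.\<close>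

definition division_pass :: "int set \<Rightarrow> int set" where
  "division_pass B =
     (let C = discard_multiples B;
          b1 = Min C;
          b2 = Min (C - {b1});
          q = nat (b2 div b1)
      in (derived ^^ q) C)"

text \<open>The least element exists for every finite set of positive integers with gcd 1; see
  \<open>ex_pass_one\<close> below.\<close>

definition \<delta> :: "int set \<Rightarrow> nat" where
  "\<delta> A = (LEAST k. 1 \<in> (division_pass ^^ k) A)"

definition admissible :: "int set \<Rightarrow> bool" where
  "admissible A \<longleftrightarrow> finite A \<and> (\<forall>x\<in>A. 0 < x) \<and> Gcd A = 1"

lemma discard_multiples_props:
  assumes "admissible B" "1 \<notin> B"
  defines "C \<equiv> discard_multiples B"
  shows "admissible C" "Min C = Min B" "Min B \<in> C" "C - {Min B} \<noteq> {}" "1 < Min B"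
    "\<And>x. x \<in> C - {Min B} \<Longrightarrow> \<not> Min B dvd x \<and> Min B < x"
proof -
  have ne: "B \<noteq> {}" and fin: "finite B" using assms(1) by (auto simp: admissible_def)
  have m: "Min B \<in> B" using ne fin by simp
  then have "0 < Min B" "Min B \<noteq> 1" using assms(1,2) by (auto simp: admissible_def)
  then show gt: "1 < Min B" by linarith
  show mC: "Min B \<in> C" using m by (simp add: C_def discard_multiples_def)
  have sub: "C \<subseteq> B" by (auto simp: C_def discard_multiples_def)
  have finC: "finite C" using sub fin by (rule finite_subset)
  show "Min C = Min B" by (rule Min_eqI) (use finC mC sub fin in auto)
  show "\<And>x. x \<in> C - {Min B} \<Longrightarrow> \<not> Min B dvd x \<and> Min B < x"
    using sub fin by (fastforce simp: C_def discard_multiples_def order_less_le)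
  have "Gcd C dvd b" if "b \<in> B" for b
  proof (cases "Min B dvd b")
    case True
    then show ?thesis using Gcd_dvd[OF mC] dvd_trans by blast
  next
    case False
    then show ?thesis using that by (intro Gcd_dvd) (auto simp: C_def discard_multiples_def)
  qed
  then have "Gcd C dvd Gcd B" by (simp add: Gcd_greatest)
  then have G: "Gcd C = 1" using assms(1) by (simp add: admissible_def)
  then show "admissible C" using finC sub assms(1) by (auto simp: admissible_def)
  show "C - {Min B} \<noteq> {}"
  proof
    assume "C - {Min B} = {}"
    then have "C = {Min B}" using mC by auto
    then show False using G gt by simp
  qed
qed

lemma derived_funpow:
  assumes "finite C" "C - {Min C} \<noteq> {}" "0 < Min C"
    and "int k \<le> Min (C - {Min C}) div Min C" "\<And>x. x \<in> C \<Longrightarrow> x \<noteq> Min C \<Longrightarrow> \<not> Min C dvd x"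
  shows "(derived ^^ k) C = insert (Min C) ((\<lambda>x. x - int k * Min C) ` (C - {Min C}))"
  using assms(4)
proof (induction k)
  case 0
  have "Min C \<in> C" using assms(1,2) by (intro Min_in) auto
  then show ?case by auto
next
  case (Suc k)
  let ?b = "Min C" and ?D = "C - {Min C}"
  let ?S = "insert ?b ((\<lambda>x. x - int k * ?b) ` ?D)"
  have IH: "(derived ^^ k) C = ?S" using Suc by simp
  have gt: "?b < x - int k * ?b" if "x \<in> ?D" for x
  proof -
    have "(int k + 1) * ?b \<le> (Min ?D div ?b) * ?b"
      using Suc.prems assms(3) by (intro mult_right_mono) auto
    also have "\<dots> \<le> Min ?D" using assms(3) by (metis div_mult_mod_eq le_add_same_cancel1 pos_mod_sign)
    also have "\<dots> \<le> x" using that assms(1) by auto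
    finally have "(int k + 1) * ?b \<le> x" .
    moreover have "(int k + 1) * ?b \<noteq> x" using assms(5)[of x] that by auto
    ultimately show ?thesis by (simp add: algebra_simps)
  qed
  have M: "Min ?S = ?b" by (rule Min_eqI) (use gt assms(1) in \<open>auto intro: less_imp_le\<close>)
  have "?S - {?b} = (\<lambda>x. x - int k * ?b) ` ?D" using gt by fastforce
  then have "derived ?S = insert ?b ((\<lambda>x. x - ?b) ` (\<lambda>x. x - int k * ?b) ` ?D)"
    by (simp only: derived_def M)
  also have "\<dots> = insert ?b ((\<lambda>x. x - int (Suc k) * ?b) ` ?D)"
    by (simp add: image_image algebra_simps)
  finally show ?case using IH by simp
qed

lemma division_pass_props:
  assumes "admissible B" "1 \<notin> B"
  shows "admissible (division_pass B)"
    and "Min (division_pass B) = Min (discard_multiples B - {Min B}) mod Min B"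
proof -
  define C where "C = discard_multiples B"
  define b where "b = Min B"
  define D where "D = C - {b}"
  define q where "q = Min D div b"
  note P = discard_multiples_props[OF assms, folded C_def b_def, folded D_def]
  have finC: "finite C" "finite D" using P(1) by (auto simp: admissible_def D_def)
  have MD: "Min D \<in> D" using P(4) finC by simp
  have q0: "0 \<le> q" using P(5,6) MD unfolding q_def by (intro pos_imp_zdiv_nonneg_iff[THEN iffD2]) force+
  have E: "division_pass B = insert b ((\<lambda>x. x - q * b) ` D)"
  proof -
    have "division_pass B = (derived ^^ nat q) C"
      by (simp add: division_pass_def Let_def C_def[symmetric] P(2) D_def[symmetric] q_def)
    also have "\<dots> = insert b ((\<lambda>x. x - q * b) ` D)"
      using derived_funpow[of C "nat q", unfolded P(2), folded D_def] finC P(4,5,6) q0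
      by (simp add: q_def D_def)
    finally show ?thesis .
  qed
  have r: "Min D - q * b = Min D mod b" by (simp add: q_def minus_div_mult_eq_mod)
  have rpos: "0 < Min D mod b" using P(5) P(6)[OF MD] pos_mod_sign[of b "Min D"]
    by (simp add: dvd_eq_mod_eq_0 order_less_le)
  have rle: "Min D mod b \<le> x - q * b" if "x \<in> D" for x
    using Min_le[OF finC(2) that] r by linarith
  have "Min (division_pass B) = Min D mod b" unfolding E
  proof (rule Min_eqI)
    show "Min D mod b \<in> insert b ((\<lambda>x. x - q * b) ` D)" using MD r[symmetric] by blast
  qed (use finC rle P(5) pos_mod_bound[of b "Min D"] in \<open>auto intro: less_imp_le\<close>)
  then show "Min (division_pass B) = Min (discard_multiples B - {Min B}) mod Min B"
    by (simp add: D_def C_def b_def)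
  have "Gcd (division_pass B) dvd x" if "x \<in> C" for x
  proof -
    have g: "Gcd (division_pass B) dvd b" by (rule Gcd_dvd) (simp add: E)
    show ?thesis
    proof (cases "x = b")
      case False
      then have "Gcd (division_pass B) dvd x - q * b" using that by (intro Gcd_dvd) (auto simp: E D_def)
      then have "Gcd (division_pass B) dvd (x - q * b) + q * b" using g by (intro dvd_add) auto
      then show ?thesis by simp
    qed (use g in simp)
  qed
  then have "Gcd (division_pass B) dvd Gcd C" by (simp add: Gcd_greatest)
  then have "Gcd (division_pass B) = 1" using P(1) by (simp add: admissible_def)
  moreover have "\<forall>x\<in>division_pass B. 0 < x" using rle rpos P(5) by (force simp: E)
  ultimately show "admissible (division_pass B)" using finC by (simp add: admissible_def E)
qed

lemma ex_pass_one:
  assumes "admissible A"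
  shows "\<exists>k. 1 \<in> (division_pass ^^ k) A"
  using assms
proof (induction "nat (Min A)" arbitrary: A rule: less_induct)
  case less
  show ?case
  proof (cases "1 \<in> A")
    case True
    then show ?thesis by (intro exI[of _ 0]) simp
  next
    case False
    have "1 < Min A" using discard_multiples_props(5)[OF less.prems False] .
    then have "nat (Min (division_pass A)) < nat (Min A)"
      by (simp add: division_pass_props(2)[OF less.prems False] nat_less_eq_zless)
    then obtain k where "1 \<in> (division_pass ^^ k) (division_pass A)"
      using less.hyps division_pass_props(1)[OF less.prems False] by blast
    then show ?thesis by (intro exI[of _ "Suc k"]) (simp add: funpow_Suc_right del: funpow.simps)
  qed
qed

lemma \<delta>_eq_0: "1 \<in> A \<Longrightarrow> \<delta> A = 0"
  by (simp add: \<delta>_def)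

lemma \<delta>_step:
  assumes "admissible A" "1 \<notin> A"
  shows "\<delta> A = Suc (\<delta> (division_pass A))"
proof -
  obtain k where "1 \<in> (division_pass ^^ k) A" using ex_pass_one[OF assms(1)] by blast
  then have "\<delta> A = Suc (LEAST m. 1 \<in> (division_pass ^^ Suc m) A)"
    unfolding \<delta>_def using assms(2) by (intro Least_Suc) auto
  then show ?thesis by (simp add: \<delta>_def funpow_Suc_right del: funpow.simps)
qed

end

theory Submission imports Defs begin

text \<open>
  This is Lame's argument for the Euclidean algorithm. A pass divides the second smallest
  element \<open>b\<^sub>2\<close> of the set without the discarded multiples by the smallest one \<open>b\<^sub>1\<close>;
  the remainder \<open>r\<close> becomes the new minimum, while
  \<open>b\<^sub>1\<close> survives as a larger element of the new set. So if the new set, which needs one pass fewer,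
  already satisfies the Fibonacci bounds, then its minimum gives \<open>r \<ge> F \<delta>\<close> and its other element
  \<open>b\<^sub>1\<close> gives \<open>b\<^sub>1 \<ge> F (\<delta> + 1)\<close>. An element \<open>x \<noteq> b\<^sub>1\<close> of the old set is either a non-multiple of
  \<open>b\<^sub>1\<close>, and then \<open>x \<ge> b\<^sub>2 \<ge> b\<^sub>1 + r \<ge> F (\<delta> + 2)\<close>, or one of the discarded multiples, and then
  \<open>x \<ge> 2 b\<^sub>1\<close>, which is at least \<open>b\<^sub>1 + r\<close> as well.

  For the induction to work, the bound on the second smallest element is stated for every element
  other than the minimum, and the sets containing \<open>1\<close> are included: there \<open>\<delta> = 0\<close>, and the bounds
  \<open>1\<close> and \<open>2\<close> are trivial.
\<close>

text \<open>Before each subtraction step of a pass, \<open>Min B\<close> is still the minimum: so it is the number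
  that is subtracted from the others, and the step keeps it.\<close>

lemma Min_mem_division_pass:
  assumes "admissible B" "1 \<notin> B"
  shows "Min B \<in> division_pass B"
proof -
  define C where "C = discard_multiples B"
  note P = discard_multiples_props[OF assms, folded C_def]
  define D where "D = C - {Min B}"
  have fin: "finite C" "finite D"
    using P(1) by (auto simp: admissible_def D_def)
  have "Min D \<in> D"
    using fin(2) P(4) unfolding D_def by (rule Min_in)
  then have "0 \<le> Min D div Min B"
    using P(5) P(6)[of "Min D"] by (simp add: D_def pos_imp_zdiv_nonneg_iff)
  then have "(derived ^^ nat (Min D div Min B)) C =
      insert (Min B) ((\<lambda>x. x - int (nat (Min D div Min B)) * Min B) ` D)"
    using derived_funpow[of C "nat (Min D div Min B)", unfolded P(2), folded D_def] fin P(4,5,6)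
    by (simp add: D_def)
  then show ?thesis
    by (simp add: division_pass_def Let_def C_def[symmetric] P(2) D_def[symmetric])
qed

text \<open>The quotient of the division is at least \<open>1\<close>, so every element is bounded below by divisor
  plus remainder; a discarded multiple of the divisor is at least its double.\<close>

lemma Min_plus_Min_division_pass_le:
  assumes "admissible B" "1 \<notin> B" "x \<in> B" "x \<noteq> Min B"
  shows "Min B + Min (division_pass B) \<le> x"
proof -
  define C where "C = discard_multiples B"
  note P = discard_multiples_props[OF assms(1,2), folded C_def]
  define D where "D = C - {Min B}"
  have fin: "finite B" "finite D"
    using assms(1) P(1) by (auto simp: admissible_def D_def)
  have r: "Min (division_pass B) = Min D mod Min B"
    using division_pass_props(2)[OF assms(1,2)] by (simp add: D_def C_def)
  have lt: "Min B < x"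
    using assms(3,4) fin by (simp add: order_less_le)
  show ?thesis
  proof (cases "Min B dvd x")
    case True
    then have "Min B dvd x - Min B" by simp
    then have "Min B \<le> x - Min B" using lt by (intro zdvd_imp_le) auto
    moreover have "Min D mod Min B < Min B" using P(5) by simp
    ultimately show ?thesis using r by linarith
  next
    case False
    then have xD: "x \<in> D"
      using assms(3,4) by (simp add: D_def C_def discard_multiples_def)
    then have MD: "Min D \<in> D" using fin by (auto intro: Min_in)
    have "Min D mod Min B = (Min D - Min B) mod Min B" by simp
    also have "\<dots> \<le> Min D - Min B"
      using P(5) P(6)[of "Min D"] MD by (intro zmod_le_nonneg_dividend) (auto simp: D_def)
    finally have "Min B + Min D mod Min B \<le> Min D" by simp
    also have "\<dots> \<le> x" using xD fin by simp
    finally show ?thesis using r by simp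
  qed
qed

text \<open>The induction is on the minimum, since each pass replaces it by a remainder modulo itself.\<close>

lemma fibonacci_bounds:
  assumes "admissible A"
  shows "int (F (\<delta> A + 1)) \<le> Min A \<and> (\<forall>x\<in>A. x \<noteq> Min A \<longrightarrow> int (F (\<delta> A + 2)) \<le> x)"
  using assms
proof (induction "nat (Min A)" arbitrary: A rule: less_induct)
  case (less A)
  have fin: "finite A" and pos: "\<forall>x\<in>A. 0 < x"
    using less.prems by (auto simp: admissible_def)
  show ?case
  proof (cases "1 \<in> A")
    case True
    have "Min A = 1"
      using True fin pos by (intro Min_eqI) force+
    moreover have "2 \<le> x" if "x \<in> A" "x \<noteq> 1" for x
      using pos that by force
    ultimately show ?thesis
      using F_1 F_2 by (auto simp: \<delta>_eq_0[OF True] numeral_2_eq_2)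
  next
    case False
    define B where "B = division_pass A"
    have gt: "1 < Min A"
      using discard_multiples_props(5)[OF less.prems False] .
    have MinB: "Min B < Min A"
      using gt by (simp add: B_def division_pass_props(2)[OF less.prems False])
    have "int (F (\<delta> B + 1)) \<le> Min B \<and> (\<forall>x\<in>B. x \<noteq> Min B \<longrightarrow> int (F (\<delta> B + 2)) \<le> x)"
      using MinB gt division_pass_props(1)[OF less.prems False]
      by (intro less.hyps) (auto simp: B_def)
    moreover have "Min A \<in> B" "Min A \<noteq> Min B"
      using Min_mem_division_pass[OF less.prems False] MinB by (auto simp: B_def)
    ultimately have r: "int (F (\<delta> B + 1)) \<le> Min B" and b1: "int (F (\<delta> B + 2)) \<le> Min A"
      by auto
    have d: "\<delta> A + 1 = \<delta> B + 2" "\<delta> A + 2 = (\<delta> B + 1) + 2"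
      using \<delta>_step[OF less.prems False] by (simp_all add: B_def)
    have "int (F (\<delta> A + 2)) = int (F (\<delta> B + 2)) + int (F (\<delta> B + 1))"
      using F_rec[of "\<delta> B + 1"] by (simp only: d(2)) (simp add: numeral_2_eq_2)
    then have "int (F (\<delta> A + 2)) \<le> x" if "x \<in> A" "x \<noteq> Min A" for x
      using Min_plus_Min_division_pass_le[OF less.prems False that] r b1
      unfolding B_def by linarith
    moreover have "int (F (\<delta> A + 1)) \<le> Min A"
      using b1 by (simp only: d(1))
    ultimately show ?thesis by blast
  qed
qed

theorem theorem4p5:
  fixes a :: "nat \<Rightarrow> int" and n :: nat and A :: "int set"
  assumes "A = a ` {1..n}"
    and "strict_mono_on {1..n} a"
    and "0 < a 1"
    and "Gcd A = 1"
    and "1 < a 1"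
  shows "a 1 \<ge> int (F (\<delta> A + 1)) \<and> a 2 \<ge> int (F (\<delta> A + 2))"
proof -
  \<comment> \<open>The gcd of the empty set is \<open>0\<close>, that of a singleton is its element: so \<open>a 2\<close> belongs to \<open>A\<close>.\<close>
  have "n \<noteq> 0" using assms(1,4) by (intro notI) simp
  moreover have "n \<noteq> 1" using assms(1,4,5) by (intro notI) simp
  ultimately have n: "2 \<le> n" by linarith
  have le: "a 1 \<le> x" if "x \<in> A" for x
    using that n assms(1) strict_mono_on_leD[OF assms(2)] by fastforce
  have "admissible A"
    using assms(1,3,4) le by (force simp: admissible_def)
  moreover have "Min A = a 1"
    using assms(1) n le by (intro Min_eqI) auto
  moreover have "a 2 \<in> A" using assms(1) n by simp
  moreover have "a 1 < a 2" using strict_mono_onD[OF assms(2), of 1 2] n by simp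
  ultimately show ?thesis using fibonacci_bounds[of A] by force
qed

end
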